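(* Let $f: \mathbb{N} \to [0,\infty)$ be a non-increasing function satisfying \[ \lim_{q \to \infty} f(q) = 0, \qquad \sum_{q=1}^\infty f(q) = \infty. \] Then there exists a set $S \subseteq \mathbb{N}$ and an uncountable set $\Gamma \subseteq \mathbb{R}$ containing $\mathbb{Q}$ such that if $\gamma \in \Gamma$ then \[ \sum_{q \in S} f(q) = \infty, \qquad \lambda(W(\mathbf{1}_S f, \gamma)) = 0. \]
   Context: $\mathbb{N}$ denotes the positive integers and $\lambda$ denotes Lebesgue measure on $\mathbb{R}$. For $x \in \mathbb{R}$, $\|x\| = \min\{|x-a| : a \in \mathbb{Z}\}$. For $\psi: \mathbb{N} \to [0,\infty)$ and $\gamma \in \mathbb{R}$, \[ W(\psi,\gamma) = \{\alpha \in [0,1] : \|q\alpha - \gamma\| < \psi(q) \text{ for infinitely many } q \in \mathbb{N}\}. \] $\mathbf{1}_S$ denotes the indicator function of $S$, and $\mathbf{1}_S f$ is the pointwise product. *)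

theory Defs
  imports "HOL-Analysis.Analysis"
begin

text \<open>Positive integers are the elements of \<open>{1..}\<close> of type \<^typ>\<open>nat\<close>; functions on them are functions on
  \<^typ>\<open>nat\<close> whose value at \<open>0\<close> is never used.\<close>

text \<open>The infimum over the integers is a minimum, see \<open>int_dist_attained\<close> and \<open>int_dist_le\<close>.\<close>

definition int_dist :: "real \<Rightarrow> real" where
  "int_dist x = (INF a\<in>\<int>. \<bar>x - a\<bar>)"

definition W :: "(nat \<Rightarrow> real) \<Rightarrow> real \<Rightarrow> real set" where
  "W \<psi> \<gamma> = {\<alpha>\<in>{0..1}. infinite {q\<in>{1..}. int_dist (real q * \<alpha> - \<gamma>) < \<psi> q}}"

lemma int_dist_infdist: "int_dist x = infdist x \<int>"
proof -
  have "(\<int> :: real set) \<noteq> {}" by (metis Ints_0 empty_iff)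
  then show ?thesis by (simp add: int_dist_def infdist_def dist_real_def)
qed

lemma int_dist_attained: "\<exists>a\<in>\<int>. int_dist x = \<bar>x - a\<bar>"
proof -
  have "(\<int> :: real set) \<noteq> {}" by (metis Ints_0 empty_iff)
  then show ?thesis
    using infdist_attains_inf[of \<int> x] by (auto simp: int_dist_infdist dist_real_def)
qed

lemma int_dist_le: "a \<in> \<int> \<Longrightarrow> int_dist x \<le> \<bar>x - a\<bar>"
  using infdist_le[of a \<int> x] by (simp add: int_dist_infdist dist_real_def)

text \<open>Measurability matters because \<^const>\<open>emeasure\<close> is \<open>0\<close> by convention on non-measurable sets.\<close>

lemma W_borel: "W \<psi> \<gamma> \<in> sets borel"
proof -
  have *: "open {\<alpha>. int_dist (real q * \<alpha> - \<gamma>) < \<psi> q}" for q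
    unfolding int_dist_infdist by (intro open_Collect_less continuous_intros)
  have "W \<psi> \<gamma> = {0..1} \<inter> (\<Inter>n. \<Union>q\<in>{max 1 n..}. {\<alpha>. int_dist (real q * \<alpha> - \<gamma>) < \<psi> q})"
    unfolding W_def infinite_nat_iff_unbounded_le by (auto simp: Bex_def) blast+
  also have "\<dots> \<in> sets borel"
    using * by (intro sets.Int sets.countable_INT sets.countable_UN'') auto
  finally show ?thesis .
qed

lemma W_lebesgue: "W \<psi> \<gamma> \<in> sets lebesgue"
  using W_borel by simp

end

theory Submission
  imports Defs "HOL-Number_Theory.Totient"
begin

text \<open>The set \<open>S\<close> is a union of finite blocks \<open>S\<^sub>i\<close>. Each block carries a large part of the sum, at least \<open>i\<close>, and
yet only a small set of \<open>\<alpha>\<close> satisfies \<open>\<parallel>q\<alpha>\<parallel> < f q\<close> for some \<open>q\<close> in the block. This is possible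
because the approximating fractions of different \<open>q\<close> coincide.

For one block, take an odd \<open>P\<close> and, for each \<open>n dvd P\<close>, the unique \<open>m\<^sub>n = n 2\<^bsup>e n\<^esup>\<close> in \<open>[P, 2P)\<close>.
Every fraction \<open>a / m\<^sub>n\<close> can be written as \<open>a' / m\<^sub>k\<close> with \<open>k dvd n\<close> and \<open>a'\<close> coprime to \<open>k\<close>. Hence
the unit interval has only about \<open>\<Sum>k. (\<phi>(k) / k) m\<^sub>k\<close> such fractions in place of \<open>\<Sum>n. m\<^sub>n\<close>, \<open>k\<close> and \<open>n\<close>
running through the divisors of \<open>P\<close> (\<open>emeasure_near_fractions_le\<close>). For \<open>P\<close> a product of distinct odd
primes, the average of \<open>\<phi>(k) / k\<close> over the divisors is \<open>\<Prod>p. 1 - 1/(2p)\<close>, which can be made arbitrarily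
small since the harmonic series diverges (\<open>odd_small_average_totient_ratio\<close>). The block consists of the
products \<open>m\<^sub>n (1 + 2Pk)\<close>, which are pairwise distinct, where \<open>k\<close> runs through a finite set on which
\<open>f\<close> does not drop by more than a factor \<open>4\<close> between \<open>P(1 + 2Pk)\<close> and \<open>2P(1 + 2Pk)\<close>. Divergence of
\<open>\<Sum>f\<close> provides enough such \<open>k\<close>, and \<open>f \<longlonglongrightarrow> 0\<close> allows the sum over the block to be tuned
(\<open>exists_sparse_block\<close>).

The bound for a block also holds for \<open>\<parallel>t q \<alpha>\<parallel> < c f q\<close>, with a loss of the factor \<open>c\<close> only. This
covers a shift by a rational \<open>r / t\<close>, because \<open>\<parallel>q\<alpha> - r/t\<parallel> < 2 f q\<close> implies \<open>\<parallel>t q \<alpha>\<parallel> < 2 t f q\<close>.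
Choose blocks \<open>S\<^sub>i\<close> and denominators \<open>t\<^sub>i\<close> alternately: \<open>S\<^sub>i\<close> is so sparse that the factor \<open>2 t\<^sub>i\<close> is
harmless, and \<open>t\<^sub>i\<^sub>+\<^sub>1\<close> is a multiple of \<open>(i + 1) t\<^sub>i\<close> that is large in comparison with \<open>1 / f\<close> on \<open>S\<^sub>i\<close>.
Let \<open>\<Gamma>\<close> consist of the numbers whose distance from some multiple of \<open>1 / t\<^sub>i\<close> is at most \<open>1 / N\<^sub>i\<close> for all
large \<open>i\<close>, where \<open>1 / N\<^sub>i \<le> f q\<close> for all \<open>q\<close> in \<open>S\<^sub>i\<close>. It contains all rationals, as well as the sums
\<open>\<Sum>j\<in>B. 1 / t\<^sub>j\<close> for \<open>B \<subseteq> \<nat>\<close>, which are pairwise distinct and therefore uncountably many. The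
Borel-Cantelli lemma finishes the proof.\<close>

section \<open>Divisors with a small totient ratio on average\<close>

text \<open>This is the inequality \<open>\<Sum>1/n \<le> \<Prod>1/(1 - 1/p)\<close> of Euler. If \<open>s(A)\<close> is the sum over the
\<open>n \<le> N\<close> with all prime factors in \<open>A\<close>, then splitting off the multiples of a new prime \<open>p\<close> gives
\<open>s(A \<union> {p}) \<le> s(A) + s(A \<union> {p}) / p\<close>.\<close>

lemma smooth_harmonic_sum_le:
  fixes A :: "nat set"
  assumes "finite A" and "\<And>p. p \<in> A \<Longrightarrow> prime p"
  shows "(\<Sum>n | n \<in> {1..N} \<and> prime_factors n \<subseteq> A. 1 / real n) * (\<Prod>p\<in>A. 1 - 1 / real p) \<le> 1"
  using assms
proof (induction A rule: finite_induct)
  case empty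
  have "{n \<in> {1..N}. prime_factors n \<subseteq> {}} \<subseteq> {1}"
    by (auto simp: prime_factorization_empty_iff)
  then have "(\<Sum>n | n \<in> {1..N} \<and> prime_factors n \<subseteq> {}. 1 / real n) \<le> (\<Sum>n\<in>{1}. 1 / real n)"
    by (intro sum_mono2) auto
  then show ?case by simp
next
  case (insert p A)
  define T where "T B = {n \<in> {1..N}. prime_factors n \<subseteq> B}" for B
  define s where "s B = (\<Sum>n\<in>T B. 1 / real n)" for B
  have fin: "finite (T B)" for B by (simp add: T_def)
  have p: "prime p" using insert by auto
  have p1: "p > 1" using p prime_gt_1_nat by blast
  have sub: "T (insert p A) \<subseteq> T A \<union> (\<lambda>n. p * n) ` T (insert p A)"
  proof
    fix n assume n: "n \<in> T (insert p A)"
    show "n \<in> T A \<union> (\<lambda>n. p * n) ` T (insert p A)"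
    proof (cases "p dvd n")
      case True
      then obtain m where m: "n = p * m" by blast
      then have "m > 0" using n by (auto simp: T_def)
      have "prime_factors m \<subseteq> prime_factors n"
        using m n by (intro dvd_prime_factors) (auto simp: T_def)
      moreover have "m \<le> n" using m p1 by simp
      ultimately have "m \<in> T (insert p A)" using n \<open>m > 0\<close> by (auto simp: T_def)
      then show ?thesis using m by blast
    next
      case False
      then have "p \<notin> prime_factors n" by auto
      then show ?thesis using n by (auto simp: T_def)
    qed
  qed
  have "s (insert p A) \<le> (\<Sum>n\<in>T A \<union> (\<lambda>n. p * n) ` T (insert p A). 1 / real n)"
    unfolding s_def by (rule sum_mono2) (use fin sub in auto)
  also have "\<dots> \<le> s A + (\<Sum>n\<in>(\<lambda>n. p * n) ` T (insert p A). 1 / real n)"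
    unfolding s_def
    by (subst sum_Un) (use fin in \<open>auto intro!: sum_nonneg\<close>)
  also have "(\<Sum>n\<in>(\<lambda>n. p * n) ` T (insert p A). 1 / real n) = (\<Sum>n\<in>T (insert p A). 1 / (real p * real n))"
    using p1 by (subst sum.reindex) (auto simp: inj_on_def)
  also have "\<dots> = 1 / real p * s (insert p A)"
    by (simp add: s_def sum_distrib_left)
  finally have "s (insert p A) * (1 - 1 / real p) \<le> s A"
    by (simp add: algebra_simps)
  then have "s (insert p A) * (1 - 1 / real p) * (\<Prod>p\<in>A. 1 - 1 / real p) \<le> s A * (\<Prod>p\<in>A. 1 - 1 / real p)"
  proof (rule mult_right_mono)
    show "0 \<le> (\<Prod>p\<in>A. 1 - 1 / real p)"
    proof (rule prod_nonneg)
      fix q assume "q \<in> A"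
      then have "q > 0" using insert.prems by (simp add: prime_gt_0_nat)
      then show "0 \<le> 1 - 1 / real q" by simp
    qed
  qed
  also have "\<dots> \<le> 1"
    using insert by (simp add: s_def T_def)
  finally show ?case
    using insert.hyps by (simp add: s_def T_def mult.assoc)
qed

lemma prod_one_minus_inverse_primes_small:
  fixes \<epsilon> :: real
  assumes "\<epsilon> > 0"
  shows "\<exists>A::nat set. finite A \<and> (\<forall>p\<in>A. prime p) \<and> 2 \<notin> A \<and> (\<Prod>p\<in>A. 1 - 1 / real p) < \<epsilon>"
proof -
  obtain N :: nat where N: "(\<Sum>n=1..N. 1 / real n) > 2 / \<epsilon>"
  proof -
    have "\<not> summable (\<lambda>n. inverse (real (Suc n)))"
      using not_summable_harmonic[where 'a=real] by (subst summable_Suc_iff) 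
    then have "\<not> (\<forall>n. (\<Sum>i<n. inverse (real (Suc i))) \<le> 2 / \<epsilon>)"
      by (intro notI) (use summableI_nonneg_bounded[of "\<lambda>n. inverse (real (Suc n))" "2/\<epsilon>"] in auto)
    then obtain n where "(\<Sum>i<n. inverse (real (Suc i))) > 2 / \<epsilon>" by (auto simp: not_le)
    moreover have "(\<Sum>i<n. inverse (real (Suc i))) = (\<Sum>n=1..n. 1 / real n)"
      by (simp add: sum.atLeast1_atMost_eq inverse_eq_divide)
    ultimately show ?thesis using that by simp
  qed
  define A where "A = {p. prime p \<and> p \<le> N}"
  have fA: "finite A" by (simp add: A_def)
  have fac: "1 - 1 / real p > 0" if "prime p" for p :: nat
    using prime_gt_1_nat[OF that] by simp
  have eq: "{n \<in> {1..N}. prime_factors n \<subseteq> A} = {1..N}"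
    by (auto simp: A_def in_prime_factors_iff dest!: dvd_imp_le)
  have *: "(\<Sum>n=1..N. 1 / real n) * (\<Prod>p\<in>A. 1 - 1 / real p) \<le> 1"
    using smooth_harmonic_sum_le[OF fA, of N] unfolding eq by (simp add: A_def)
  have pos: "(\<Prod>p\<in>A. 1 - 1 / real p) > 0"
    by (rule prod_pos) (use fac in \<open>simp add: A_def\<close>)
  have "2 / \<epsilon> * (\<Prod>p\<in>A. 1 - 1 / real p) < 1"
    using mult_strict_right_mono[OF N pos] * by linarith
  then have lt: "(\<Prod>p\<in>A. 1 - 1 / real p) < \<epsilon> / 2"
    using assms by (simp add: field_simps)
  have "(\<Prod>p\<in>A. 1 - 1 / real p) \<ge> (\<Prod>p\<in>A-{2}. 1 - 1 / real p) / 2"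
  proof (cases "2 \<in> A")
    case True
    then show ?thesis by (simp add: prod.remove[OF fA])
  next
    case False
    then show ?thesis using pos by simp
  qed
  with lt have "(\<Prod>p\<in>A-{2}. 1 - 1 / real p) < \<epsilon>" by linarith
  then show ?thesis
    using fA by (intro exI[of _ "A - {2}"]) (auto simp: A_def)
qed

lemma divisor_sums_prod_primes:
  assumes "finite A" and "\<And>p. p \<in> A \<Longrightarrow> prime (p::nat)"
  shows "(\<Sum>n | n dvd \<Prod>A. totient n / real n) = (\<Prod>p\<in>A. 2 - 1 / real p)"
    and "card {n. n dvd \<Prod>A} = 2 ^ card A"
proof -
  have "(\<Sum>n | n dvd \<Prod>A. totient n / real n) = (\<Prod>p\<in>A. 2 - 1 / real p) \<and> card {n. n dvd \<Prod>A} = 2 ^ card A"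
    using assms
  proof (induction A rule: finite_induct)
    case empty
    then show ?case by simp
  next
    case (insert p A)
    define P where "P = \<Prod>A"
    have p: "prime p" and p0: "p > 0" using insert.prems by (auto simp: prime_gt_0_nat)
    have P0: "P > 0" unfolding P_def using insert.prems by (auto intro!: prod_pos simp: prime_gt_0_nat)
    have fin: "finite {n. n dvd P}" using P0 by simp
    have ndvd: "\<not> p dvd P"
    proof
      assume "p dvd P"
      then obtain q where "q \<in> A" "p dvd q"
        unfolding P_def using p insert.hyps(1) by (auto simp: prime_dvd_prod_iff)
      then show False using p insert by (metis insertI2 primes_dvd_imp_eq)
    qed
    have cop: "coprime p n" if "n dvd P" for n
      using ndvd p that by (meson dvd_trans prime_imp_coprime)
    have split: "{n. n dvd p * P} = {n. n dvd P} \<union> (\<lambda>n. p * n) ` {n. n dvd P}"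
    proof (intro equalityI subsetI)
      fix n assume "n \<in> {n. n dvd p * P}"
      then have n: "n dvd p * P" by simp
      show "n \<in> {n. n dvd P} \<union> (\<lambda>n. p * n) ` {n. n dvd P}"
      proof (cases "p dvd n")
        case True
        then obtain m where "n = p * m" by blast
        then show ?thesis using n p0 by auto
      next
        case False
        then have "coprime n p" using p by (metis coprime_commute prime_imp_coprime)
        then show ?thesis using n by (simp add: coprime_dvd_mult_right_iff)
      qed
    qed auto
    have disj: "{n. n dvd P} \<inter> (\<lambda>n. p * n) ` {n. n dvd P} = {}"
      using ndvd by (auto dest: dvd_mult_left)
    have inj: "inj_on (\<lambda>n. p * n) {n. n dvd P}" using p0 by (auto simp: inj_on_def)
    have IH: "(\<Sum>n | n dvd P. totient n / real n) = (\<Prod>p\<in>A. 2 - 1 / real p)" "card {n. n dvd P} = 2 ^ card A"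
      using insert by (auto simp: P_def)
    have "(\<Sum>n\<in>(\<lambda>n. p * n) ` {n. n dvd P}. totient n / real n)
        = (\<Sum>n | n dvd P. (1 - 1 / real p) * (totient n / real n))"
      unfolding sum.reindex[OF inj] o_def
    proof (rule sum.cong[OF refl])
      fix n assume "n \<in> {n. n dvd P}"
      then have "totient (p * n) = (p - 1) * totient n"
        using cop p by (simp add: totient_mult_coprime totient_prime)
      then show "totient (p * n) / real (p * n) = (1 - 1 / real p) * (totient n / real n)"
        using p0 by (simp add: field_simps of_nat_diff)
    qed
    also have "\<dots> = (1 - 1 / real p) * (\<Sum>n | n dvd P. totient n / real n)"
      by (simp add: sum_distrib_left)
    finally have "(\<Sum>n | n dvd p * P. totient n / real n) = (2 - 1 / real p) * (\<Sum>n | n dvd P. totient n / real n)"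
      unfolding split using fin disj by (subst sum.union_disjoint) (auto simp: algebra_simps)
    moreover have "card {n. n dvd p * P} = 2 * card {n. n dvd P}"
      unfolding split using fin disj inj by (subst card_Un_disjoint) (auto simp: card_image)
    ultimately show ?case
      using insert.hyps IH by (simp add: P_def)
  qed
  then show "(\<Sum>n | n dvd \<Prod>A. totient n / real n) = (\<Prod>p\<in>A. 2 - 1 / real p)"
    "card {n. n dvd \<Prod>A} = 2 ^ card A" by auto
qed

lemma odd_small_average_totient_ratio:
  fixes \<epsilon> :: real
  assumes "\<epsilon> > 0"
  shows "\<exists>P::nat. odd P \<and> (\<Sum>n | n dvd P. totient n / real n) \<le> \<epsilon> * card {n. n dvd P}"
proof -
  obtain A :: "nat set" where A: "finite A" "\<And>p. p \<in> A \<Longrightarrow> prime p" "2 \<notin> A"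
    and small: "(\<Prod>p\<in>A. 1 - 1 / real p) < \<epsilon> ^ 4"
    using prod_one_minus_inverse_primes_small[of "\<epsilon> ^ 4"] assms by auto
  have odd: "odd (\<Prod>A)"
    using A by (auto simp: even_prod_iff) (metis primes_dvd_imp_eq two_is_prime_nat)
  \<comment> \<open>This comparison reduces the claim to the product of the factors \<open>1 - 1/p\<close>.\<close>
  have step: "(1 - 1 / (2 * real p)) ^ 4 \<le> 1 - 1 / real p" if "p \<in> A" for p
  proof -
    define x where "x = 1 / (2 * real p)"
    have "p \<ge> 2" using A that prime_ge_2_nat by blast
    then have x: "0 \<le> x" "x \<le> 1/4" by (auto simp: x_def field_simps)
    have "0 \<le> x * (2 - 6 * x + 4 * x\<^sup>2 - x ^ 3)"
    proof (rule mult_nonneg_nonneg)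
      have "x ^ 3 \<le> 1 / 4" using power_mono[OF x(2) x(1), of 3] by (simp add: power3_eq_cube)
      moreover have "0 \<le> x\<^sup>2" by simp
      ultimately show "0 \<le> 2 - 6 * x + 4 * x\<^sup>2 - x ^ 3" using x by linarith
    qed (use x in auto)
    then have "(1 - x) ^ 4 \<le> 1 - 2 * x"
      by (simp add: power4_eq_xxxx power3_eq_cube power2_eq_square algebra_simps)
    then show ?thesis by (simp add: x_def)
  qed
  have half: "0 \<le> 1 - 1 / (2 * real p)" if "p \<in> A" for p
    using A that prime_ge_2_nat[of p] by (auto simp: field_simps)
  have "(\<Prod>p\<in>A. 1 - 1 / (2 * real p)) ^ 4 = (\<Prod>p\<in>A. (1 - 1 / (2 * real p)) ^ 4)"
    by (simp add: prod_power_distrib)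
  also have "\<dots> \<le> (\<Prod>p\<in>A. 1 - 1 / real p)"
    by (rule prod_mono) (use step half in auto)
  also have "\<dots> \<le> \<epsilon> ^ 4" using small by simp
  finally have *: "(\<Prod>p\<in>A. 1 - 1 / (2 * real p)) \<le> \<epsilon>"
    using assms power_mono_iff[of "\<Prod>p\<in>A. 1 - 1 / (2 * real p)" \<epsilon> 4] half
    by (simp add: prod_nonneg)
  have "(\<Prod>p\<in>A. 2 - 1 / real p) = (\<Prod>p\<in>A. 2 * (1 - 1 / (2 * real p)))"
    by (rule prod.cong) (auto simp: algebra_simps)
  also have "\<dots> = 2 ^ card A * (\<Prod>p\<in>A. 1 - 1 / (2 * real p))"
    by (simp only: prod.distrib prod_constant)
  also have "\<dots> \<le> 2 ^ card A * \<epsilon>" using * by simp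
  finally have "(\<Sum>n | n dvd \<Prod>A. totient n / real n) \<le> \<epsilon> * card {n. n dvd \<Prod>A}"
    using divisor_sums_prod_primes[OF A(1,2)] by (simp add: mult.commute)
  then show ?thesis using odd by blast
qed

section \<open>The measure of the points near a family of fractions\<close>

lemma borel_near_integer:
  shows "{\<alpha> \<in> {0..1}. \<exists>i\<in>I. int_dist (r i * \<alpha> - \<gamma>) < \<delta> i} \<in> sets borel"
proof -
  have *: "open {\<alpha>. int_dist (r i * \<alpha> - \<gamma>) < \<delta> i}" for i
    unfolding int_dist_infdist by (intro open_Collect_less continuous_intros)
  have "{\<alpha> \<in> {0..1}. \<exists>i\<in>I. int_dist (r i * \<alpha> - \<gamma>) < \<delta> i}
      = {0..1} \<inter> (\<Union>i\<in>I. {\<alpha>. int_dist (r i * \<alpha> - \<gamma>) < \<delta> i})"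
    by auto
  also have "\<dots> \<in> sets borel"
    using * by (intro sets.Int borel_open[OF open_UN] borel_closed[of "{0..1}"]) auto
  finally show ?thesis .
qed

lemma card_coprime_residues: "n > 0 \<Longrightarrow> card {r. r < n \<and> coprime r n} = totient n"
proof (cases "n = 1")
  case True
  then have "{r. r < n \<and> coprime r n} = {0}" by auto
  then show ?thesis using True by simp
next
  case False
  assume "n > 0"
  with False have "{r. r < n \<and> coprime r n} = totatives n"
    by (auto simp: in_totatives_iff le_less intro!: Nat.gr0I)
  then show ?thesis by (simp add: totient_def)
qed

lemma card_coprime_upto_le:
  assumes "n > 0" "N > 0"
  shows "card {a. a \<le> N * n \<and> coprime a n} \<le> 2 * N * totient n"
proof -
  let ?R = "{r. r < n \<and> coprime r n}"
  have "inj_on (\<lambda>a. (a div n, a mod n)) {a. a \<le> N * n \<and> coprime a n}"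
    by (rule inj_onI) (metis Pair_inject div_mult_mod_eq)
  moreover have "(\<lambda>a. (a div n, a mod n)) ` {a. a \<le> N * n \<and> coprime a n} \<subseteq> {..N} \<times> ?R"
    using assms div_le_mono[of _ "N * n" n] by auto
  ultimately have "card {a. a \<le> N * n \<and> coprime a n} \<le> card ({..N} \<times> ?R)"
    by (intro card_inj_on_le) auto
  also have "\<dots> = (N + 1) * totient n"
    using assms by (simp add: card_cartesian_product card_coprime_residues)
  also have "\<dots> \<le> 2 * N * totient n"
    using assms by (intro mult_right_mono) auto
  finally show ?thesis .
qed

text \<open>The factor \<open>Q\<close> is arbitrary and does not enter the bound: it multiplies the number of fractions
and divides their permitted distance from \<open>\<alpha>\<close>.\<close>

lemma emeasure_near_fractions_le:
  fixes P Q Z :: nat and e :: "nat \<Rightarrow> nat" and \<delta> :: real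
  assumes "odd P" and "Q > 0" and "\<delta> \<ge> 0"
    and e: "\<And>n. n dvd P \<Longrightarrow> Z \<le> n * 2 ^ e n \<and> n * 2 ^ e n < 2 * Z"
  shows "emeasure lborel {\<alpha> \<in> {0..1}. \<exists>n\<in>{n. n dvd P}. int_dist (real (Q * (n * 2 ^ e n)) * \<alpha>) < \<delta>}
    \<le> ennreal (8 * \<delta> * (\<Sum>n | n dvd P. totient n / real n))"
proof -
  have P0: "P > 0" using \<open>odd P\<close> by (auto intro!: Nat.gr0I)
  have fin: "finite {n. n dvd P}" using P0 by simp
  have Z0: "Z > 0" using e[of 1] by (auto intro!: Nat.gr0I)
  have n0: "n > 0" if "n dvd P" for n using that P0 by (auto intro!: Nat.gr0I)
  \<comment> \<open>Since all \<open>n 2\<^bsup>e n\<^esup>\<close> lie in \<open>[Z, 2Z)\<close>, a divisor comes with at least as large a power of two.\<close>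
  have e_mono: "e n \<le> e k" if "k dvd n" "n dvd P" for k n
  proof (rule ccontr)
    assume "\<not> e n \<le> e k"
    then have "Suc (e k) \<le> e n" by simp
    then have "k * 2 ^ Suc (e k) \<le> n * 2 ^ e n"
      using dvd_imp_le[OF that(1) n0[OF that(2)]] by (intro mult_mono power_increasing) auto
    moreover have "Z \<le> k * 2 ^ e k" using e that dvd_trans by blast
    ultimately show False using e[OF that(2)] by simp
  qed
  define C where "C n = {a. a \<le> (Q * 2 ^ e n) * n \<and> coprime a n}" for n
  define \<rho> where "\<rho> = \<delta> / (Q * Z)"
  define I where "I n a = {a / real (Q * (n * 2 ^ e n)) - \<rho> .. a / real (Q * (n * 2 ^ e n)) + \<rho>}" for n a :: nat
  have finC: "finite (C n)" for n
    by (rule finite_subset[of _ "{..(Q * 2 ^ e n) * n}"]) (auto simp: C_def)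
  have cover: "{\<alpha> \<in> {0..1}. \<exists>n\<in>{n. n dvd P}. int_dist (real (Q * (n * 2 ^ e n)) * \<alpha>) < \<delta>}
      \<subseteq> (\<Union>n\<in>{n. n dvd P}. \<Union>a\<in>C n. I n a)"
  proof
    fix \<alpha> assume "\<alpha> \<in> {\<alpha> \<in> {0..1}. \<exists>n\<in>{n. n dvd P}. int_dist (real (Q * (n * 2 ^ e n)) * \<alpha>) < \<delta>}"
    then obtain n where \<alpha>: "0 \<le> \<alpha>" "\<alpha> \<le> 1" and n: "n dvd P"
      and d: "int_dist (real (Q * (n * 2 ^ e n)) * \<alpha>) < \<delta>" by auto
    define m where "m = n * 2 ^ e n"
    have m: "Z \<le> m" using e[OF n] by (simp add: m_def)
    have m0: "m > 0" using m Z0 by simp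
    define x where "x = real (Q * m) * \<alpha>"
    have x: "0 \<le> x" "x \<le> real (Q * m)" using \<alpha> by (auto simp: x_def mult_left_le)
    obtain b :: int where b: "int_dist x = \<bar>x - b\<bar>" using int_dist_attained[of x] by (auto elim: Ints_cases)
    have "\<bar>x - b\<bar> < \<delta>" using d b by (simp only: x_def m_def)
    then have rd: "\<bar>x - round x\<bar> < \<delta>"
      using round_diff_minimal[of x b] by linarith
    have r0: "0 \<le> round x" using round_mono[OF x(1)] by simp
    have r1: "round x \<le> int (Q * m)" using round_mono[OF x(2)] by (metis round_of_nat)
    \<comment> \<open>Rounding, unlike an arbitrary nearby integer, keeps the numerator between \<open>0\<close> and \<open>Q m\<close>.\<close>
    define a where "a = nat (round x)"
    have a: "a \<le> Q * m" "\<bar>x - real a\<bar> < \<delta>" using r0 r1 rd by (auto simp: a_def nat_le_iff)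
    \<comment> \<open>Cancel the common factor of \<open>a\<close> and \<open>n\<close>, then expand by a power of two.\<close>
    define g where "g = gcd a n"
    define n' where "n' = n div g"
    define a' where "a' = a div g * 2 ^ (e n' - e n)"
    have g0: "g > 0" using n0[OF n] by (simp add: g_def)
    have ng: "n = n' * g" by (simp add: n'_def g_def)
    have ag: "a = a div g * g" by (simp add: g_def)
    have n'n: "n' dvd n" using ng by simp
    then have n'P: "n' dvd P" using n dvd_trans by blast
    have en: "2 ^ e n' = 2 ^ e n * (2 ^ (e n' - e n) :: nat)"
      using e_mono[OF n'n n] by (simp flip: power_add)
    have odd': "odd n'" using n'P \<open>odd P\<close> dvd_trans by blast
    have "coprime (a div g) n'"
      unfolding g_def n'_def using n0[OF n] by (intro div_gcd_coprime) auto
    then have cop: "coprime a' n'" using odd' by (simp add: a'_def)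
    have "a div g * g \<le> Q * (n' * g * 2 ^ e n)" using a(1) ng ag by (simp add: m_def)
    then have "g * (a div g) \<le> g * (Q * n' * 2 ^ e n)" by (simp add: ac_simps)
    then have "a div g \<le> Q * n' * 2 ^ e n" using g0 by simp
    then have "a' \<le> Q * n' * 2 ^ e n * 2 ^ (e n' - e n)"
      unfolding a'_def by (rule mult_right_mono) simp
    then have "a' \<le> (Q * 2 ^ e n') * n'" by (simp add: en ac_simps)
    then have a'C: "a' \<in> C n'" using cop by (simp add: C_def)
    have "a' * n * 2 ^ e n = a * n' * 2 ^ e n'"
      unfolding a'_def en by (subst ng, subst (2) ag) (simp add: ac_simps)
    then have "real a' * (real n * 2 ^ e n) = real a * (real n' * 2 ^ e n')"
      by (metis (mono_tags, lifting) mult.assoc of_nat_mult of_nat_numeral of_nat_power)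
    then have frac: "a' / real (Q * (n' * 2 ^ e n')) = a / real (Q * m)"
      using \<open>Q > 0\<close> n0[OF n] n0[OF n'P] by (simp add: m_def field_simps)
    have "\<bar>\<alpha> - a / real (Q * m)\<bar> = \<bar>x - a\<bar> / real (Q * m)"
      using \<open>Q > 0\<close> m0 by (simp add: x_def abs_div_pos[symmetric] field_simps del: of_nat_mult)
    also have "\<dots> \<le> \<delta> / real (Q * Z)"
      using a(2) m Z0 \<open>Q > 0\<close> by (intro frac_le) (auto simp: mult_left_mono simp flip: of_nat_mult)
    finally have "\<alpha> \<in> I n' a'"
      unfolding I_def frac \<rho>_def by (auto simp: abs_le_iff)
    then show "\<alpha> \<in> (\<Union>n\<in>{n. n dvd P}. \<Union>a\<in>C n. I n a)"
      using a'C n'P by blast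
  qed
  have \<rho>0: "\<rho> \<ge> 0" using \<open>\<delta> \<ge> 0\<close> by (simp add: \<rho>_def)
  have each: "(\<Sum>a\<in>C n. emeasure lborel (I n a)) \<le> ennreal (8 * \<delta> * (totient n / real n))"
    if n: "n dvd P" for n
  proof -
    have "(\<Sum>a\<in>C n. emeasure lborel (I n a)) = (\<Sum>a\<in>C n. ennreal (2 * \<rho>))"
      using \<rho>0 by (intro sum.cong) (auto simp: I_def)
    also have "\<dots> = ennreal (card (C n) * (2 * \<rho>))"
      using \<rho>0 by (subst sum_ennreal) auto
    also have "\<dots> \<le> ennreal (real (2 * (Q * 2 ^ e n) * totient n) * (2 * \<rho>))"
      unfolding C_def using \<rho>0 \<open>Q > 0\<close> n0[OF n]
      by (intro ennreal_leI mult_right_mono of_nat_mono card_coprime_upto_le) auto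
    also have "real (2 * (Q * 2 ^ e n) * totient n) * (2 * \<rho>) = 4 * \<delta> * totient n / real n * (real (n * 2 ^ e n) / Z)"
      using \<open>Q > 0\<close> n0[OF n] by (simp add: \<rho>_def field_simps)
    also have "\<dots> \<le> 4 * \<delta> * totient n / real n * 2"
    proof (rule mult_left_mono)
      have "real (n * 2 ^ e n) \<le> real (2 * Z)" using e[OF n] by (intro of_nat_mono) auto
      then show "real (n * 2 ^ e n) / Z \<le> 2" using Z0 by (simp add: field_simps)
    qed (use \<open>\<delta> \<ge> 0\<close> in auto)
    also have "\<dots> = 8 * \<delta> * (totient n / real n)" by simp
    finally show ?thesis by (simp add: ennreal_leI mult.assoc)
  qed
  have "emeasure lborel {\<alpha> \<in> {0..1}. \<exists>n\<in>{n. n dvd P}. int_dist (real (Q * (n * 2 ^ e n)) * \<alpha>) < \<delta>}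
      \<le> emeasure lborel (\<Union>n\<in>{n. n dvd P}. \<Union>a\<in>C n. I n a)"
    by (rule emeasure_mono[OF cover]) (use fin finC in \<open>auto simp: I_def\<close>)
  also have "\<dots> \<le> (\<Sum>n | n dvd P. emeasure lborel (\<Union>a\<in>C n. I n a))"
    by (rule emeasure_subadditive_finite) (use fin finC in \<open>auto simp: I_def\<close>)
  also have "\<dots> \<le> (\<Sum>n | n dvd P. \<Sum>a\<in>C n. emeasure lborel (I n a))"
    by (intro sum_mono emeasure_subadditive_finite) (use finC in \<open>auto simp: I_def\<close>)
  also have "\<dots> \<le> (\<Sum>n | n dvd P. ennreal (8 * \<delta> * (totient n / real n)))"
    by (intro sum_mono each) auto
  also have "\<dots> = ennreal (8 * \<delta> * (\<Sum>n | n dvd P. totient n / real n))"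
    using \<open>\<delta> \<ge> 0\<close> by (subst sum_ennreal) (auto simp: sum_distrib_left)
  finally show ?thesis .
qed

section \<open>Subseries of divergent antimonotone series\<close>

lemma not_summable_select_sum:
  fixes u :: "nat \<Rightarrow> real"
  assumes "\<And>k. 0 \<le> u k" and "\<not> summable u" and "0 < \<tau>" and "\<And>k. A \<le> k \<Longrightarrow> u k \<le> \<tau>"
  obtains B where "\<tau> \<le> sum u {A..<B}" and "sum u {A..<B} \<le> 2 * \<tau>"
proof -
  have "\<exists>B. \<tau> \<le> sum u {A..<B}"
  proof (rule ccontr)
    assume "\<nexists>B. \<tau> \<le> sum u {A..<B}"
    then have less: "sum u {A..<B} < \<tau>" for B by (meson not_le)
    have "sum u {..<n} \<le> sum u {..<A} + \<tau>" for n
    proof -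
      have "sum u {..<n} \<le> sum u ({..<A} \<union> {A..<n})"
        using assms(1) by (intro sum_mono2) auto
      also have "\<dots> = sum u {..<A} + sum u {A..<n}"
        by (intro sum.union_disjoint) auto
      finally show ?thesis using less[of n] by linarith
    qed
    then show False using assms(1,2) summableI_nonneg_bounded[of u] by blast
  qed
  define B where "B = (LEAST B. \<tau> \<le> sum u {A..<B})"
  have B: "\<tau> \<le> sum u {A..<B}"
    unfolding B_def using \<open>\<exists>B. _\<close> by (rule LeastI_ex)
  have "A < B" using B \<open>0 < \<tau>\<close> by (cases "A < B") auto
  then obtain B' where B': "B = Suc B'" "A \<le> B'" by (cases B) auto
  have "sum u {A..<B'} < \<tau>"
    using not_less_Least[of B' "\<lambda>B. \<tau> \<le> sum u {A..<B}"] B' by (simp add: B_def[symmetric] not_le)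
  moreover have "sum u {A..<B} = sum u {A..<B'} + u B'" using B' by simp
  ultimately have "sum u {A..<B} \<le> 2 * \<tau>" using assms(4)[OF B'(2)] by linarith
  with B that show ?thesis by blast
qed

lemma not_summable_arith_progression:
  fixes f :: "nat \<Rightarrow> real"
  assumes nonneg: "\<And>q. q \<in> {1..} \<Longrightarrow> 0 \<le> f q" and mono: "antimono_on {1..} f"
    and div: "\<not> summable f" and "0 < a" "0 < b"
  shows "\<not> summable (\<lambda>k. f (a + b * k))"
proof
  assume sm: "summable (\<lambda>k. f (a + b * k))"
  have "sum (\<lambda>i. f (i + a)) {..<n} \<le> real b * (\<Sum>k. f (a + b * k))" for n
  proof -
    have "n * 1 \<le> n * b" using \<open>0 < b\<close> by (intro mult_le_mono2) simp
    then have "sum (\<lambda>i. f (i + a)) {..<n} \<le> sum (\<lambda>i. f (i + a)) {..<n * b}"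
      using nonneg \<open>0 < a\<close> by (intro sum_mono2) auto
    also have "\<dots> = (\<Sum>m<n. \<Sum>i\<in>{m * b..<m * b + b}. f (i + a))"
      by (simp add: sum.nat_group)
    also have "\<dots> \<le> (\<Sum>m<n. \<Sum>i\<in>{m * b..<m * b + b}. f (a + b * m))"
      using \<open>0 < a\<close> by (intro sum_mono monotone_onD[OF mono]) (auto simp: mult.commute)
    also have "\<dots> = real b * (\<Sum>m<n. f (a + b * m))"
      by (simp add: sum_distrib_left)
    also have "\<dots> \<le> real b * (\<Sum>k. f (a + b * k))"
      using sm nonneg \<open>0 < a\<close> by (intro mult_left_mono sum_le_suminf) auto
    finally show ?thesis .
  qed
  then have "summable (\<lambda>i. f (i + a))"
    using nonneg \<open>0 < a\<close> by (intro summableI_nonneg_bounded) auto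
  then show False using div by (simp add: summable_iff_shift)
qed

text \<open>Suitable for \<open>g k = F k\<close> and \<open>h k = F (2 k)\<close> with \<open>F\<close> antimonotone. The terms with \<open>4 h k < g k\<close>
contribute at most half of \<open>\<Sum>h\<close> up to a constant, because \<open>\<Sum>g\<close> is at most \<open>2 \<Sum>h\<close> up to a
constant.\<close>

lemma not_summable_restrict_doubling:
  fixes g h :: "nat \<Rightarrow> real"
  assumes nonneg: "\<And>k. 0 \<le> g k" "\<And>k. 0 \<le> h k" and mono: "antimono g"
    and gh: "\<And>k. g (2 * k + 1) \<le> h k" and div: "\<not> summable g"
  shows "\<not> summable (\<lambda>k. if g k \<le> 4 * h k then h k else 0)"
proof
  define u where "u = (\<lambda>k. if g k \<le> 4 * h k then h k else 0)"
  assume "summable (\<lambda>k. if g k \<le> 4 * h k then h k else 0)"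
  then have sm: "summable u" by (simp add: u_def)
  have two: "(\<Sum>j<2 * n + 1. g j) \<le> g 0 + 2 * (\<Sum>k<n. h k)" for n
  proof (induction n)
    case (Suc n)
    have "g (2 * n + 2) \<le> g (2 * n + 1)" using mono by (auto intro: antimonoD)
    then show ?case using Suc gh[of n] by simp
  qed simp
  have bound: "(\<Sum>j<2 * n + 1. g j) \<le> 2 * g 0 + 4 * suminf u" for n
  proof -
    have "(\<Sum>k<n. h k) \<le> (\<Sum>k<n. u k + g k / 4)"
      using nonneg by (intro sum_mono) (auto simp: u_def)
    also have "\<dots> = (\<Sum>k<n. u k) + (\<Sum>k<n. g k) / 4"
      by (simp add: sum.distrib sum_divide_distrib)
    also have "(\<Sum>k<n. u k) \<le> suminf u"
      using sm by (rule sum_le_suminf) (use nonneg in \<open>auto simp: u_def\<close>)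
    also have "(\<Sum>k<n. g k) \<le> (\<Sum>j<2 * n + 1. g j)"
      using nonneg by (intro sum_mono2) auto
    finally have "(\<Sum>k<n. h k) \<le> suminf u + (\<Sum>j<2 * n + 1. g j) / 4" by simp
    then show ?thesis using two[of n] by argo
  qed
  have "(\<Sum>j<n. g j) \<le> 2 * g 0 + 4 * suminf u" for n
  proof -
    have "(\<Sum>j<n. g j) \<le> (\<Sum>j<2 * n + 1. g j)" using nonneg by (intro sum_mono2) auto
    then show ?thesis using bound[of n] by linarith
  qed
  then have "summable g" using nonneg by (intro summableI_nonneg_bounded) auto
  with div show False ..
qed

section \<open>A block with large sum and small measure\<close>

text \<open>The block does not depend on \<open>t\<close> and \<open>c\<close>. The factor \<open>t\<close> makes the bound applicable to shifts by
rationals with denominator \<open>t\<close>.\<close>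

lemma exists_sparse_block:
  fixes f :: "nat \<Rightarrow> real" and T \<epsilon> :: real
  assumes nonneg: "\<And>q. q \<in> {1..} \<Longrightarrow> 0 \<le> f q" and mono: "antimono_on {1..} f"
    and lim: "f \<longlonglongrightarrow> 0" and div: "\<not> summable f" and "0 < T" "0 < \<epsilon>"
  shows "\<exists>S. finite S \<and> S \<subseteq> {1..} \<and> T \<le> sum f S \<and>
    (\<forall>t>0. \<forall>c\<ge>0. emeasure lborel {\<alpha> \<in> {0..1}. \<exists>q\<in>S. int_dist (real (t * q) * \<alpha>) < c * f q}
      \<le> ennreal (c * \<epsilon>))"
proof -
  obtain P :: nat where "odd P" and
    P: "(\<Sum>n | n dvd P. totient n / real n) \<le> \<epsilon> / (64 * T) * card {n. n dvd P}"
    using odd_small_average_totient_ratio[of "\<epsilon> / (64 * T)"] \<open>0 < T\<close> \<open>0 < \<epsilon>\<close> by auto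
  have P0: "P > 0" using \<open>odd P\<close> by (auto intro!: Nat.gr0I)
  define D where "D = {n. n dvd P}"
  define d where "d = real (card D)"
  have finD: "finite D" using P0 by (simp add: D_def)
  have "1 \<in> D" by (simp add: D_def)
  then have d0: "d > 0" unfolding d_def using finD by (auto simp: card_gt_0_iff)
  have Dn: "0 < n" "n \<le> P" if "n \<in> D" for n
    using that P0 by (auto simp: D_def intro: dvd_imp_le intro!: Nat.gr0I)
  have "\<exists>e. \<forall>n\<in>D. P \<le> n * 2 ^ e n \<and> n * 2 ^ e n < 2 * P"
  proof (rule bchoice, intro ballI)
    fix n assume n: "n \<in> D"
    define k where "k = (LEAST k. P \<le> n * 2 ^ k)"
    have "P \<le> n * 2 ^ P"
      using mult_le_mono[of 1 n P "2 ^ P"] Dn[OF n] less_exp[of P] by simp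
    then have k: "P \<le> n * 2 ^ k" unfolding k_def by (rule LeastI)
    moreover have "n * 2 ^ k < 2 * P"
    proof (cases k)
      case 0
      then show ?thesis using Dn[OF n] P0 by simp
    next
      case (Suc j)
      then have "n * 2 ^ j < P"
        using not_less_Least[of j "\<lambda>k. P \<le> n * 2 ^ k"] by (simp add: k_def[symmetric])
      then show ?thesis using Suc by simp
    qed
    ultimately show "\<exists>k. P \<le> n * 2 ^ k \<and> n * 2 ^ k < 2 * P" by blast
  qed
  then obtain e where e: "\<And>n. n \<in> D \<Longrightarrow> P \<le> n * 2 ^ e n \<and> n * 2 ^ e n < 2 * P" by blast
  define m where "m n = n * 2 ^ e n" for n
  define L where "L = 2 * P"
  have m: "P \<le> m n" "m n < L" if "n \<in> D" for n using e[OF that] by (auto simp: m_def L_def)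
  \<comment> \<open>The odd part of \<open>m n\<close> is \<open>n\<close>.\<close>
  have inj_m: "inj_on m D"
  proof (rule inj_onI)
    fix n n' assume nn: "n \<in> D" "n' \<in> D" "m n = m n'"
    have "odd n" "odd n'" using nn \<open>odd P\<close> dvd_trans by (auto simp: D_def)
    then have cop: "coprime n (2 ^ e n')" "coprime n' (2 ^ e n)" by auto
    have "n dvd n' * 2 ^ e n'" "n' dvd n * 2 ^ e n"
      using nn(3) unfolding m_def by (metis dvd_triv_left)+
    then show "n = n'" using cop by (simp add: coprime_dvd_mult_left_iff dvd_antisym)
  qed
  define g where "g k = f (P * (1 + L * k))" for k
  define h where "h k = f (2 * P * (1 + L * k))" for k
  have antimono: "f b \<le> f a" if "0 < a" "a \<le> b" for a b
    using monotone_onD[OF mono, of a b] that by simp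
  have gh0: "0 \<le> g k" "0 \<le> h k" for k using nonneg P0 by (auto simp: g_def h_def)
  have g_anti: "antimono g"
    unfolding g_def using P0 by (intro antimonoI antimono mult_le_mono2) auto
  have gh: "g (2 * k + 1) \<le> h k" for k
  proof -
    have "2 * (1 + L * k) \<le> 1 + L * (2 * k + 1)" using P0 by (simp add: L_def algebra_simps)
    then have "P * (2 * (1 + L * k)) \<le> P * (1 + L * (2 * k + 1))" by (rule mult_le_mono2)
    then show ?thesis unfolding g_def h_def using P0 by (intro antimono) (auto simp: ac_simps)
  qed
  have "\<not> summable (\<lambda>k. f (P + (P * L) * k))"
    using P0 by (intro not_summable_arith_progression nonneg mono div) (auto simp: L_def)
  then have "\<not> summable g" by (simp add: g_def[abs_def] algebra_simps)
  define u where "u = (\<lambda>k. if g k \<le> 4 * h k then h k else 0)"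
  have u: "\<not> summable u"
    unfolding u_def by (rule not_summable_restrict_doubling) (use gh0 g_anti gh \<open>\<not> summable g\<close> in auto)
  \<comment> \<open>Each \<open>k\<close> contributes \<open>d\<close> elements to the block, so the sum of \<open>h\<close> has to reach \<open>T / d\<close>.\<close>
  define \<tau> where "\<tau> = T / d"
  have \<tau>0: "\<tau> > 0" using \<open>0 < T\<close> d0 by (simp add: \<tau>_def)
  obtain A where A: "\<And>q. q \<ge> A \<Longrightarrow> f q \<le> \<tau>"
    using order_tendstoD(2)[OF lim \<tau>0] by (auto simp: eventually_sequentially intro: less_imp_le)
  have small: "u k \<le> \<tau>" if "A \<le> k" for k
  proof -
    have "k \<le> 2 * P * (1 + L * k)"
      using P0 by (simp add: L_def algebra_simps trans_le_add2)
    then show ?thesis using A that \<tau>0 by (auto simp: u_def h_def)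
  qed
  have u0: "0 \<le> u k" for k using gh0 by (simp add: u_def)
  obtain B where B: "\<tau> \<le> sum u {A..<B}" "sum u {A..<B} \<le> 2 * \<tau>"
    by (rule not_summable_select_sum[OF u0 u \<tau>0 small])
  define K where "K = {k \<in> {A..<B}. g k \<le> 4 * h k}"
  have finK: "finite K" by (simp add: K_def)
  have "sum u {A..<B} = sum h K"
    unfolding u_def K_def by (rule sum.inter_filter[symmetric]) simp
  with B have h_sum: "\<tau> \<le> sum h K" "sum h K \<le> 2 * \<tau>" by auto
  have "sum g K \<le> (\<Sum>k\<in>K. 4 * h k)" by (rule sum_mono) (simp add: K_def)
  also have "\<dots> \<le> 8 * \<tau>" using h_sum by (simp add: sum_distrib_left[symmetric])
  finally have g_sum: "sum g K \<le> 8 * \<tau>" .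
  define \<phi> where "\<phi> = (\<lambda>(n, k). m n * (1 + L * k))"
  \<comment> \<open>The factor \<open>m n\<close> is the residue of the product modulo \<open>L\<close>.\<close>
  have inj: "inj_on \<phi> (D \<times> K)"
  proof (rule inj_onI, clarsimp simp: \<phi>_def)
    fix n k n' k' assume nk: "n \<in> D" "n' \<in> D"
      and eq: "m n + m n * (L * k) = m n' + m n' * (L * k')"
    have "(m n + m n * (L * k)) mod L = m n" "(m n' + m n' * (L * k')) mod L = m n'"
      using m nk by (auto simp: mult.left_commute[of _ L])
    then have "m n = m n'" using eq by simp
    then show "n = n' \<and> k = k'"
      using inj_m nk eq m[of n] P0 by (auto simp: inj_on_def L_def)
  qed
  define S where "S = \<phi> ` (D \<times> K)"
  have "finite S" using finD finK by (simp add: S_def)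
  moreover have "S \<subseteq> {1..}"
    using m P0 by (fastforce simp: S_def \<phi>_def)
  moreover have "T \<le> sum f S"
  proof -
    have "T = (\<Sum>n\<in>D. \<tau>)" using d0 by (simp add: \<tau>_def d_def[symmetric])
    also have "\<dots> \<le> (\<Sum>n\<in>D. sum h K)" by (intro sum_mono h_sum)
    also have "\<dots> = (\<Sum>x\<in>D \<times> K. h (snd x))" by (simp add: sum.cartesian_product' case_prod_beta)
    also have "\<dots> \<le> (\<Sum>x\<in>D \<times> K. f (\<phi> x))"
    proof (rule sum_mono, clarsimp simp: \<phi>_def h_def)
      fix n k assume "n \<in> D" "k \<in> K"
      then have "m n * (1 + L * k) \<le> 2 * P * (1 + L * k)"
        using m[of n] by (intro mult_le_mono1) (simp add: L_def)
      then have "f (2 * P * (1 + L * k)) \<le> f (m n * (1 + L * k))"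
        using m[OF \<open>n \<in> D\<close>] P0 by (intro antimono) auto
      then show "f (2 * P + 2 * P * (L * k)) \<le> f (m n + m n * (L * k))"
        by (simp add: algebra_simps)
    qed
    also have "\<dots> = sum f S" by (simp add: S_def sum.reindex[OF inj])
    finally show ?thesis .
  qed
  moreover have "emeasure lborel {\<alpha> \<in> {0..1}. \<exists>q\<in>S. int_dist (real (t * q) * \<alpha>) < c * f q} \<le> ennreal (c * \<epsilon>)"
    if t: "t > 0" and c: "c \<ge> 0" for t c
  proof -
    define E where "E k = {\<alpha> \<in> {0..1}. \<exists>n\<in>D. int_dist (real (t * (1 + L * k) * (n * 2 ^ e n)) * \<alpha>) < c * g k}" for k
    have E_sets: "E k \<in> sets lborel" for k
      using borel_near_integer[of D "\<lambda>n. real (t * (1 + L * k) * (n * 2 ^ e n))" 0 "\<lambda>n. c * g k"]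
      by (simp add: E_def)
    have "{\<alpha> \<in> {0..1}. \<exists>q\<in>S. int_dist (real (t * q) * \<alpha>) < c * f q} \<subseteq> (\<Union>k\<in>K. E k)"
    proof
      fix \<alpha> assume "\<alpha> \<in> {\<alpha> \<in> {0..1}. \<exists>q\<in>S. int_dist (real (t * q) * \<alpha>) < c * f q}"
      then obtain n k where nk: "n \<in> D" "k \<in> K" and \<alpha>: "\<alpha> \<in> {0..1}"
        and lt: "int_dist (real (t * (m n * (1 + L * k))) * \<alpha>) < c * f (m n * (1 + L * k))"
        by (auto simp: S_def \<phi>_def)
      have "f (m n * (1 + L * k)) \<le> g k"
        unfolding g_def using m[OF nk(1)] P0 by (intro antimono mult_le_mono1) auto
      then have "c * f (m n * (1 + L * k)) \<le> c * g k" using c by (rule mult_left_mono)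
      moreover have "t * (m n * (1 + L * k)) = t * (1 + L * k) * (n * 2 ^ e n)"
        by (simp only: m_def ac_simps)
      ultimately have "int_dist (real (t * (1 + L * k) * (n * 2 ^ e n)) * \<alpha>) < c * g k"
        using lt by (metis less_le_trans)
      then show "\<alpha> \<in> (\<Union>k\<in>K. E k)" using nk \<alpha> unfolding E_def by blast
    qed
    then have "emeasure lborel {\<alpha> \<in> {0..1}. \<exists>q\<in>S. int_dist (real (t * q) * \<alpha>) < c * f q}
        \<le> emeasure lborel (\<Union>k\<in>K. E k)"
      using finK E_sets by (intro emeasure_mono sets.finite_UN) auto
    also have "\<dots> \<le> (\<Sum>k\<in>K. emeasure lborel (E k))"
      using finK E_sets by (intro emeasure_subadditive_finite) auto
    also have "\<dots> \<le> (\<Sum>k\<in>K. ennreal (8 * (c * g k) * (\<Sum>n | n dvd P. totient n / real n)))"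
      unfolding E_def D_def
      using \<open>odd P\<close> t c gh0 e
      by (intro sum_mono emeasure_near_fractions_le[where Z = P]) (auto simp: D_def)
    also have "\<dots> = ennreal (\<Sum>k\<in>K. 8 * (c * g k) * (\<Sum>n | n dvd P. totient n / real n))"
      using c gh0 by (intro sum_ennreal) (auto intro!: mult_nonneg_nonneg sum_nonneg)
    also have "(\<Sum>k\<in>K. 8 * (c * g k) * (\<Sum>n | n dvd P. totient n / real n))
        = 8 * c * sum g K * (\<Sum>n | n dvd P. totient n / real n)"
      by (simp only: sum_distrib_left[of _ g] sum_distrib_right[of _ _ "\<Sum>n | n dvd P. _ n"] mult.assoc)
    also have "\<dots> \<le> 8 * c * (8 * \<tau>) * (\<epsilon> / (64 * T) * d)"
      using P g_sum c \<tau>0 gh0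
      by (intro mult_mono) (auto simp: d_def D_def intro!: sum_nonneg mult_nonneg_nonneg)
    also have "\<dots> = c * \<epsilon>" using d0 \<open>0 < T\<close> by (simp add: \<tau>_def)
    finally show ?thesis by (simp add: ennreal_leI)
  qed
  ultimately show ?thesis by blast
qed

section \<open>Infinite sums of nonnegative reals\<close>

lemma not_summable_of_infsum_ennreal:
  fixes f :: "nat \<Rightarrow> real"
  assumes nonneg: "\<And>q. q \<in> {1..} \<Longrightarrow> 0 \<le> f q" and "(\<Sum>\<^sub>\<infinity>q\<in>{1..}. ennreal (f q)) = \<infinity>"
  shows "\<not> summable f"
proof
  assume "summable f"
  then have sm: "summable (\<lambda>q. f (Suc q))" by (simp add: summable_Suc_iff)
  define C where "C = (\<Sum>q. f (Suc q))"
  have "sum (\<lambda>q. ennreal (f q)) F \<le> ennreal C" if F: "finite F" "F \<subseteq> {1..}" for F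
  proof -
    have F_eq: "F = Suc ` ((\<lambda>q. q - 1) ` F)" using F(2) by (force simp: image_image)
    have "sum (\<lambda>q. ennreal (f q)) F = ennreal (sum f F)"
      using F nonneg by (intro sum_ennreal) auto
    also have "sum f F = (\<Sum>q\<in>(\<lambda>q. q - 1) ` F. f (Suc q))"
      by (subst F_eq, subst sum.reindex) auto
    also have "\<dots> \<le> C"
      unfolding C_def using sm nonneg F by (intro sum_le_suminf) auto
    finally show ?thesis by (simp add: ennreal_leI)
  qed
  then have "(\<Sum>\<^sub>\<infinity>q\<in>{1..}. ennreal (f q)) \<le> ennreal C"
    by (subst nonneg_infsum_complete) (auto intro!: SUP_least)
  then show False using assms(2) by (simp add: top_unique)
qed

lemma antimono_pos_of_not_summable:
  fixes f :: "nat \<Rightarrow> real"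
  assumes nonneg: "\<And>q. q \<in> {1..} \<Longrightarrow> 0 \<le> f q" and mono: "antimono_on {1..} f"
    and div: "\<not> summable f" and "q \<in> {1..}"
  shows "0 < f q"
proof (rule ccontr)
  assume "\<not> 0 < f q"
  then have "f n = 0" if "n \<ge> q" for n
    using monotone_onD[OF mono, of q n] nonneg[of n] \<open>q \<in> {1..}\<close> that by auto
  then have "summable f" by (intro summable_finite[of "{..<q}"]) (auto simp: not_less)
  with div show False ..
qed

lemma infsum_ennreal_eq_top_of_finite_sums:
  fixes f :: "nat \<Rightarrow> real"
  assumes nonneg: "\<And>q. q \<in> S \<Longrightarrow> 0 \<le> f q"
    and large: "\<And>i::nat. \<exists>F. finite F \<and> F \<subseteq> S \<and> real i \<le> sum f F"
  shows "(\<Sum>\<^sub>\<infinity>q\<in>S. ennreal (f q)) = \<infinity>"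
proof -
  have "of_nat i \<le> (\<Sum>\<^sub>\<infinity>q\<in>S. ennreal (f q))" for i
  proof -
    obtain F where F: "finite F" "F \<subseteq> S" "real i \<le> sum f F" using large by blast
    have "of_nat i = ennreal (real i)" by (simp add: ennreal_of_nat_eq_real_of_nat)
    also have "\<dots> \<le> ennreal (sum f F)" using F by (intro ennreal_leI)
    also have "\<dots> = sum (\<lambda>q. ennreal (f q)) F" using F nonneg by (intro sum_ennreal[symmetric]) auto
    also have "\<dots> \<le> (\<Sum>\<^sub>\<infinity>q\<in>S. ennreal (f q))"
      using F by (subst nonneg_infsum_complete) (auto intro!: SUP_upper)
    finally show ?thesis .
  qed
  then show ?thesis
    using ennreal_Ex_less_of_nat by (metis infinity_ennreal_def leD less_top)
qed

section \<open>Subsums of lacunary series of unit fractions\<close>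

lemma sum_unit_fractions_in_lattice:
  fixes t :: "nat \<Rightarrow> nat"
  assumes "\<And>j. 0 < t j" and "\<And>j k. j \<le> k \<Longrightarrow> t j dvd t k"
  shows "\<exists>r\<in>\<int>. (\<Sum>j<Suc i. if j \<in> B then 1 / real (t j) else 0) = r / real (t i)"
proof (intro bexI)
  show "(\<Sum>j<Suc i. if j \<in> B then 1 / real (t j) else 0)
      = (\<Sum>j<Suc i. if j \<in> B then real (t i div t j) else 0) / real (t i)"
    unfolding sum_divide_distrib using assms
    by (intro sum.cong) (auto simp: real_of_nat_div field_simps)
  show "(\<Sum>j<Suc i. if j \<in> B then real (t i div t j) else 0) \<in> \<int>"
    by (intro Ints_sum) auto
qed

lemma lacunary_tail:
  fixes t :: "nat \<Rightarrow> nat" and x :: "nat \<Rightarrow> real"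
  assumes pos: "\<And>j. 0 < t j" and grow: "\<And>j. 4 * t j \<le> t (Suc j)"
    and x: "\<And>j. x j \<in> {0, 1 / real (t j)}"
  shows "summable x" and "0 \<le> (\<Sum>j. x (j + i))" and "(\<Sum>j. x (j + i)) \<le> (4/3) / real (t i)"
proof -
  have grow': "4 ^ j * t i \<le> t (j + i)" for i j
  proof (induction j)
    case (Suc j)
    then show ?case using grow[of "j + i"] by simp
  qed simp
  have le: "x (j + i) \<le> 1 / real (t i) * (1/4) ^ j" for j i
  proof -
    have "real (4 ^ j * t i) \<le> real (t (j + i))" by (intro of_nat_mono grow')
    then have "1 / real (t (j + i)) \<le> 1 / (4 ^ j * real (t i))"
      using pos by (intro frac_le) auto
    moreover have "x (j + i) \<le> 1 / real (t (j + i))" using x[of "j + i"] by auto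
    ultimately show ?thesis by (simp add: power_one_over mult.commute)
  qed
  have x0: "0 \<le> x j" for j using x[of j] by auto
  have geom: "summable (\<lambda>j. 1 / real (t i) * (1/4::real) ^ j)" for i
    by (intro summable_mult summable_geometric) simp
  show sm: "summable x"
    by (rule summable_comparison_test'[OF geom[of 0], of 0]) (use le[of _ 0] x0 in auto)
  then have sm': "summable (\<lambda>j. x (j + i))" by (simp add: summable_iff_shift)
  show "0 \<le> (\<Sum>j. x (j + i))" using sm' x0 by (intro suminf_nonneg)
  have "(\<Sum>j. x (j + i)) \<le> (\<Sum>j. 1 / real (t i) * (1/4) ^ j)"
    by (intro suminf_le le sm' geom)
  also have "\<dots> = 1 / real (t i) * (\<Sum>j. (1/4) ^ j)"
    by (intro suminf_mult summable_geometric) simp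
  also have "(\<Sum>j. (1/4::real) ^ j) = 4 / 3"
    by (subst suminf_geometric) auto
  finally show "(\<Sum>j. x (j + i)) \<le> (4/3) / real (t i)" by simp
qed

lemma inj_lacunary_sum:
  fixes t :: "nat \<Rightarrow> nat"
  assumes pos: "\<And>j. 0 < t j" and grow: "\<And>j. 4 * t j \<le> t (Suc j)"
  shows "inj (\<lambda>B. \<Sum>j. if j \<in> B then 1 / real (t j) else 0)"
proof (rule injI, rule ccontr)
  define x where "x = (\<lambda>B j. if j \<in> B then 1 / real (t j) else 0)"
  have x: "x B j \<in> {0, 1 / real (t j)}" for B j by (simp add: x_def)
  note tail = lacunary_tail[of t "x B" for B, OF pos grow x]
  have split: "suminf (x B) = (\<Sum>j. x B (j + Suc i)) + x B i + sum (x B) {..<i}" for B i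
    using suminf_split_initial_segment[OF tail(1), of B "Suc i"] by simp
  have less: "suminf (x B') < suminf (x B)"
    if i: "i \<in> B" "i \<notin> B'" and same: "\<And>j. j < i \<Longrightarrow> j \<in> B \<longleftrightarrow> j \<in> B'" for B B' i
  proof -
    have "sum (x B) {..<i} = sum (x B') {..<i}"
      using same by (intro sum.cong) (auto simp: x_def)
    moreover have "x B i = 1 / t i" "x B' i = 0" using i by (auto simp: x_def)
    moreover have "0 \<le> (\<Sum>j. x B (j + Suc i))" by (rule tail(2))
    moreover have "(\<Sum>j. x B' (j + Suc i)) < 1 / t i"
    proof -
      have "(\<Sum>j. x B' (j + Suc i)) \<le> (4/3) / t (Suc i)" by (rule tail(3))
      also have "\<dots> \<le> (4/3) / real (4 * t i)"
        using pos[of i] grow[of i] by (intro divide_left_mono of_nat_mono mult_pos_pos) (auto simp: pos)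
      also have "\<dots> < 1 / t i" using pos[of i] by (simp add: field_simps)
      finally show ?thesis .
    qed
    ultimately show ?thesis using split[of B i] split[of B' i] by linarith
  qed
  fix B B' assume eq: "(\<Sum>j. if j \<in> B then 1 / real (t j) else 0) = (\<Sum>j. if j \<in> B' then 1 / real (t j) else 0)"
    and "B \<noteq> B'"
  then have ex: "\<exists>i. (i \<in> B) \<noteq> (i \<in> B')" by auto
  define i where "i = (LEAST i. (i \<in> B) \<noteq> (i \<in> B'))"
  have i: "(i \<in> B) \<noteq> (i \<in> B')" unfolding i_def using ex by (rule LeastI_ex)
  have same: "j \<in> B \<longleftrightarrow> j \<in> B'" if "j < i" for j
    using not_less_Least[of j "\<lambda>i. (i \<in> B) \<noteq> (i \<in> B')"] that by (auto simp: i_def)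
  have "suminf (x B) \<noteq> suminf (x B')"
    using i same less[of i B B'] less[of i B' B] by fastforce
  then show False using eq by (simp add: x_def)
qed

section \<open>Assembling the blocks\<close>

lemma emeasure_W_eq_0_of_blocks:
  fixes \<psi> :: "nat \<Rightarrow> real" and S :: "nat \<Rightarrow> nat set"
  assumes fin: "\<And>i. finite (S i)"
    and supp: "\<And>q. 0 < \<psi> q \<Longrightarrow> q \<in> (\<Union>i. S i)"
    and small: "\<And>i. m \<le> i \<Longrightarrow>
      emeasure lborel {\<alpha> \<in> {0..1}. \<exists>q\<in>S i. int_dist (real q * \<alpha> - \<gamma>) < \<psi> q} \<le> ennreal (b i)"
    and b: "summable b" "\<And>i. 0 \<le> b i"
  shows "emeasure lebesgue (W \<psi> \<gamma>) = 0"
proof -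
  define E where "E i = {\<alpha> \<in> {0..1}. \<exists>q\<in>S i. int_dist (real q * \<alpha> - \<gamma>) < \<psi> q}" for i
  have E_sets: "E i \<in> sets lborel" for i
    unfolding E_def using borel_near_integer[of "S i" real \<gamma> \<psi>] by simp
  have E_le: "emeasure lborel (E (i + m)) \<le> ennreal (b (i + m))" for i
    using small[of "i + m"] by (simp add: E_def)
  have "limsup (\<lambda>i. E (i + m)) \<in> null_sets lborel"
  proof (rule borel_cantelli_limsup1)
    show "E (i + m) \<in> sets lborel" for i by (rule E_sets)
    show "emeasure lborel (E (i + m)) < \<infinity>" for i
      using E_le[of i] by (metis ennreal_less_top infinity_ennreal_def le_less_trans)
    show "summable (\<lambda>i. measure lborel (E (i + m)))"
    proof (rule summable_comparison_test')
      show "summable (\<lambda>i. b (i + m))" using b by (simp add: summable_iff_shift)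
      show "norm (measure lborel (E (i + m))) \<le> b (i + m)" if "i \<ge> 0" for i
        using E_le[of i] b by (simp add: measure_def enn2real_leI)
    qed
  qed
  moreover have "W \<psi> \<gamma> \<subseteq> limsup (\<lambda>i. E (i + m))"
  proof
    fix \<alpha> assume \<alpha>: "\<alpha> \<in> W \<psi> \<gamma>"
    define Q where "Q = {q \<in> {1..}. int_dist (real q * \<alpha> - \<gamma>) < \<psi> q}"
    have inf: "infinite Q" and \<alpha>01: "\<alpha> \<in> {0..1}" using \<alpha> by (auto simp: W_def Q_def)
    have "\<exists>i\<ge>n. \<alpha> \<in> E (i + m)" for n
    proof -
      have "finite (\<Union>i<n + m. S i)" using fin by auto
      then obtain q where q: "q \<in> Q" "q \<notin> (\<Union>i<n + m. S i)"
        using inf by (meson finite_subset subsetI)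
      have lt: "int_dist (real q * \<alpha> - \<gamma>) < \<psi> q" using q(1) by (simp add: Q_def)
      moreover have "0 \<le> int_dist (real q * \<alpha> - \<gamma>)"
        by (simp add: int_dist_infdist infdist_nonneg)
      ultimately obtain j where j: "q \<in> S j" using supp[of q] by force
      then have "n + m \<le> j" using q(2) by (auto simp: not_less[symmetric])
      moreover have "\<alpha> \<in> E j" using j lt \<alpha>01 by (auto simp: E_def)
      ultimately show ?thesis by (intro exI[of _ "j - m"]) auto
    qed
    then show "\<alpha> \<in> limsup (\<lambda>i. E (i + m))"
      by (fastforce simp: limsup_INF_SUP)
  qed
  ultimately have "W \<psi> \<gamma> \<in> null_sets lborel"
    using W_borel null_sets_subset by (metis sets_lborel)
  then show ?thesis by (simp add: W_borel null_setsD1)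
qed

theorem theorem1p5:
  fixes f :: "nat \<Rightarrow> real"
  assumes "\<And>q. q \<in> {1..} \<Longrightarrow> 0 \<le> f q"
    and "antimono_on {1..} f"
    and "f \<longlonglongrightarrow> 0"
    and "(\<Sum>\<^sub>\<infinity>q\<in>{1..}. ennreal (f q)) = \<infinity>"
  shows "\<exists>S \<Gamma>. S \<subseteq> {1..} \<and> uncountable \<Gamma> \<and> \<rat> \<subseteq> \<Gamma> \<and>
    (\<forall>\<gamma>\<in>\<Gamma>. (\<Sum>\<^sub>\<infinity>q\<in>S. ennreal (f q)) = \<infinity> \<and>
      emeasure lebesgue (W (\<lambda>q. indicator S q * f q) \<gamma>) = 0)"
proof -
  have div: "\<not> summable f" by (rule not_summable_of_infsum_ennreal[OF assms(1,4)])
  have f_pos: "0 < f q" if "q \<in> {1..}" for q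
    by (rule antimono_pos_of_not_summable[OF assms(1,2) div that])
  \<comment> \<open>The allowance \<open>(1/2) ^ i / t\<close> absorbs the factor \<open>2 t\<close> lost in passing to a shift with denominator \<open>t\<close>.\<close>
  define block where "block i t S N \<longleftrightarrow> finite S \<and> S \<subseteq> {1..} \<and> real i \<le> sum f S \<and>
      (\<forall>c\<ge>0. emeasure lborel {\<alpha> \<in> {0..1}. \<exists>q\<in>S. int_dist (real (t * q) * \<alpha>) < c * f q}
        \<le> ennreal (c * ((1/2) ^ i / real t))) \<and>
      0 < N \<and> (\<forall>q\<in>S. 1 / real N \<le> f q)" for i t S and N :: nat
  have "\<exists>S N. 0 < t \<longrightarrow> block i t S N" for i t
  proof (cases "0 < t")
    case True
    obtain S where S: "finite S" "S \<subseteq> {1..}" "real i + 1 \<le> sum f S"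
      "\<And>c. c \<ge> 0 \<Longrightarrow> emeasure lborel {\<alpha> \<in> {0..1}. \<exists>q\<in>S. int_dist (real (t * q) * \<alpha>) < c * f q}
        \<le> ennreal (c * ((1/2) ^ i / real t))"
      using exists_sparse_block[OF assms(1-3) div, of "real i + 1" "(1/2) ^ i / real t"] True by auto
    have "S \<noteq> {}" using S(3) by auto
    then have "0 < Min (f ` S)" using S f_pos by auto
    then obtain N :: nat where N: "0 < N" "1 / real N < Min (f ` S)"
      using reals_Archimedean by (metis inverse_eq_divide zero_less_Suc)
    then have "\<forall>q\<in>S. 1 / real N \<le> f q" using S(1) by (auto intro: less_imp_le[OF less_le_trans[OF _ Min_le]])
    then have "block i t S N" using S N(1) by (auto simp: block_def)
    then show ?thesis by blast
  qed auto
  then have "\<forall>i t. \<exists>S N. 0 < t \<longrightarrow> block i t S N" by blast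
  then obtain S' N' where SN: "\<And>i t. 0 < t \<Longrightarrow> block i t (S' i t) (N' i t)"
    by (simp only: choice_iff) blast
  \<comment> \<open>The factor \<open>Suc i\<close> makes every positive integer divide \<open>t i\<close> eventually. The factor \<open>4 * N' i s\<close>
    makes \<open>\<Sum>j>i. 1 / t j\<close> at most \<open>1 / N' i s\<close>, where \<open>s = t i\<close>.\<close>
  define t where "t = rec_nat 1 (\<lambda>i s. s * (4 * Suc i * N' i s))"
  have t_Suc: "t (Suc i) = t i * (4 * Suc i * N' i (t i))" for i by (simp add: t_def)
  have t_pos: "0 < t i" for i
  proof (induction i)
    case (Suc i)
    then show ?case using SN[of "t i" i] by (simp add: t_Suc block_def)
  qed (simp add: t_def)
  define S where "S i = S' i (t i)" for i
  define N where "N i = N' i (t i)" for i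
  have bl: "block i (t i) (S i) (N i)" for i unfolding S_def N_def by (rule SN[OF t_pos])
  have N_pos: "0 < N i" for i using bl by (simp add: block_def)
  have t_dvd: "t i dvd t j" if "i \<le> j" for i j
    using that by (induction rule: dec_induct) (auto simp: t_Suc)
  have dvd_t: "s dvd t i" if "0 < s" "s \<le> i" for s i
  proof -
    obtain j where j: "s = Suc j" using \<open>0 < s\<close> by (cases s) auto
    have "t s = s * (t j * 4 * N' j (t j))" by (simp only: j t_Suc ac_simps)
    then have "s dvd t s" by (metis dvd_triv_left)
    then show ?thesis using t_dvd[OF \<open>s \<le> i\<close>] by (rule dvd_trans)
  qed
  have t_grow: "4 * t i * N i \<le> t (Suc i)" for i by (simp add: t_Suc N_def)
  have t_grow4: "4 * t i \<le> t (Suc i)" for i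
    using t_grow[of i] N_pos[of i] by (metis One_nat_def Suc_leI le_trans mult.right_neutral mult_le_mono2)
  define \<Gamma> where "\<Gamma> = {\<gamma>. \<exists>i0. \<forall>i\<ge>i0. \<exists>r\<in>\<int>. \<bar>\<gamma> - r / real (t i)\<bar> \<le> 1 / real (N i)}"
  have rat: "\<rat> \<subseteq> \<Gamma>"
  proof
    fix \<gamma> :: real assume "\<gamma> \<in> \<rat>"
    then obtain a :: int and s where s: "0 < s" "\<gamma> = of_int a / of_int s" by (rule Rats_cases')
    have "\<exists>r\<in>\<int>. \<bar>\<gamma> - r / real (t i)\<bar> \<le> 1 / real (N i)" if "nat s \<le> i" for i
    proof -
      have "nat s dvd t i" using s that by (intro dvd_t) auto
      then obtain k where k: "t i = nat s * k" by (rule dvdE)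
      have "k > 0" using k t_pos[of i] by (auto intro!: Nat.gr0I)
      then have "\<gamma> = of_int (a * int k) / real (t i)" using s by (simp add: k)
      then have "\<bar>\<gamma> - of_int (a * int k) / real (t i)\<bar> \<le> 1 / real (N i)" by simp
      then show ?thesis by (meson Ints_of_int)
    qed
    then show "\<gamma> \<in> \<Gamma>" unfolding \<Gamma>_def by blast
  qed
  define \<gamma> where "\<gamma> = (\<lambda>B. \<Sum>j. if j \<in> B then 1 / real (t j) else 0)"
  have "\<gamma> B \<in> \<Gamma>" for B
  proof -
    have "\<exists>r\<in>\<int>. \<bar>\<gamma> B - r / real (t i)\<bar> \<le> 1 / real (N i)" for i
    proof -
      define x where "x = (\<lambda>B j. if j \<in> B then 1 / real (t j) else 0)"
      have x: "x B j \<in> {0, 1 / real (t j)}" for j by (simp add: x_def)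
      note tail = lacunary_tail[of t "x B", OF t_pos t_grow4 x]
      obtain r where r: "r \<in> \<int>" "sum (x B) {..<Suc i} = r / real (t i)"
        using sum_unit_fractions_in_lattice[of t, OF t_pos t_dvd] unfolding x_def by blast
      have "\<gamma> B - r / real (t i) = (\<Sum>j. x B (j + Suc i))"
        using suminf_split_initial_segment[OF tail(1), of "Suc i"] r(2) by (simp add: \<gamma>_def x_def)
      moreover have "(\<Sum>j. x B (j + Suc i)) \<le> (4/3) / t (Suc i)" by (rule tail(3))
      moreover have "(4/3) / t (Suc i) \<le> (4/3) / real (4 * t i * N i)"
        using t_grow[of i] t_pos N_pos by (intro divide_left_mono of_nat_mono mult_pos_pos) auto
      moreover have "(4/3) / real (4 * t i * N i) \<le> 1 / real (N i)"
        using t_pos[of i] N_pos[of i] by (simp add: field_simps)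
      moreover have "0 \<le> (\<Sum>j. x B (j + Suc i))" by (rule tail(2))
      ultimately have "\<bar>\<gamma> B - r / real (t i)\<bar> \<le> 1 / real (N i)" by linarith
      then show ?thesis using r(1) by blast
    qed
    then show ?thesis by (simp add: \<Gamma>_def)
  qed
  then have "range \<gamma> \<subseteq> \<Gamma>" by blast
  moreover have "uncountable (range \<gamma>)"
  proof
    assume "countable (range \<gamma>)"
    moreover have "inj \<gamma>" unfolding \<gamma>_def by (rule inj_lacunary_sum[of t, OF t_pos t_grow4])
    ultimately have "countable (UNIV :: nat set set)" by (rule countable_image_inj_on)
    then show False
      using nat_sets_eqpoll_reals uncountable_UNIV_real countable_eqpoll eqpoll_sym by blast
  qed
  ultimately have unc: "uncountable \<Gamma>" by (meson countable_subset)
  define U where "U = (\<Union>i. S i)"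
  have U1: "U \<subseteq> {1..}" using bl by (auto simp: U_def block_def)
  have "(\<Sum>\<^sub>\<infinity>q\<in>U. ennreal (f q)) = \<infinity>"
  proof (rule infsum_ennreal_eq_top_of_finite_sums)
    show "0 \<le> f q" if "q \<in> U" for q using assms(1) U1 that by blast
    show "\<exists>F. finite F \<and> F \<subseteq> U \<and> real i \<le> sum f F" for i
      using bl[of i] by (intro exI[of _ "S i"]) (auto simp: block_def U_def)
  qed
  moreover have "emeasure lebesgue (W (\<lambda>q. indicator U q * f q) \<gamma>) = 0" if "\<gamma> \<in> \<Gamma>" for \<gamma>
  proof -
    obtain i0 where i0: "\<And>i. i \<ge> i0 \<Longrightarrow> \<exists>r\<in>\<int>. \<bar>\<gamma> - r / real (t i)\<bar> \<le> 1 / real (N i)"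
      using \<open>\<gamma> \<in> \<Gamma>\<close> unfolding \<Gamma>_def by blast
    show ?thesis
    proof (rule emeasure_W_eq_0_of_blocks[where S = S and m = i0 and b = "\<lambda>i. 2 * (1/2) ^ i"])
      show "finite (S i)" for i using bl by (simp add: block_def)
      show "q \<in> (\<Union>i. S i)" if "0 < indicator U q * f q" for q
        using that by (cases "q \<in> U") (auto simp: U_def)
      show "summable (\<lambda>i. 2 * (1/2::real) ^ i)" by (intro summable_mult summable_geometric) simp
      fix i assume "i0 \<le> i"
      then obtain r where r: "r \<in> \<int>" "\<bar>\<gamma> - r / real (t i)\<bar> \<le> 1 / real (N i)" using i0 by blast
      have sub: "{\<alpha> \<in> {0..1}. \<exists>q\<in>S i. int_dist (real q * \<alpha> - \<gamma>) < indicator U q * f q}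
          \<subseteq> {\<alpha> \<in> {0..1}. \<exists>q\<in>S i. int_dist (real (t i * q) * \<alpha>) < 2 * real (t i) * f q}"
      proof clarify
        fix \<alpha> q assume q: "q \<in> S i" and lt: "int_dist (real q * \<alpha> - \<gamma>) < indicator U q * f q"
        have "q \<in> U" using q by (auto simp: U_def)
        obtain a where a: "a \<in> \<int>" "int_dist (real q * \<alpha> - \<gamma>) = \<bar>real q * \<alpha> - \<gamma> - a\<bar>"
          using int_dist_attained by blast
        have "1 / real (N i) \<le> f q" using bl q by (simp add: block_def)
        then have "\<bar>real q * \<alpha> - a - r / real (t i)\<bar> < 2 * f q"
          using lt a(2) r(2) \<open>q \<in> U\<close> by simp
        then have "real (t i) * \<bar>real q * \<alpha> - a - r / real (t i)\<bar> < real (t i) * (2 * f q)"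
          using t_pos[of i] by (intro mult_strict_left_mono) auto
        also have "real (t i) * \<bar>real q * \<alpha> - a - r / real (t i)\<bar>
            = \<bar>real (t i) * (real q * \<alpha> - a - r / real (t i))\<bar>"
          by (simp add: abs_mult)
        also have "real (t i) * (real q * \<alpha> - a - r / real (t i)) = real (t i * q) * \<alpha> - (real (t i) * a + r)"
          using t_pos[of i] by (simp add: algebra_simps)
        finally have "\<bar>real (t i * q) * \<alpha> - (real (t i) * a + r)\<bar> < 2 * real (t i) * f q" by simp
        moreover have "real (t i) * a + r \<in> \<int>" using a(1) r(1) by simp
        ultimately have "int_dist (real (t i * q) * \<alpha>) < 2 * real (t i) * f q"
          using int_dist_le le_less_trans by blast
        then show "\<exists>q\<in>S i. int_dist (real (t i * q) * \<alpha>) < 2 * real (t i) * f q" using q by blast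
      qed
      have "emeasure lborel {\<alpha> \<in> {0..1}. \<exists>q\<in>S i. int_dist (real q * \<alpha> - \<gamma>) < indicator U q * f q}
          \<le> emeasure lborel {\<alpha> \<in> {0..1}. \<exists>q\<in>S i. int_dist (real (t i * q) * \<alpha>) < 2 * real (t i) * f q}"
        using borel_near_integer[of "S i" "\<lambda>q. real (t i * q)" 0 "\<lambda>q. 2 * real (t i) * f q"]
        by (intro emeasure_mono[OF sub]) simp
      also have "\<dots> \<le> ennreal (2 * real (t i) * ((1/2) ^ i / real (t i)))"
        using bl[of i] by (simp only: block_def)
      also have "2 * real (t i) * ((1/2) ^ i / real (t i)) = 2 * (1/2) ^ i"
        using t_pos[of i] by simp
      finally show "emeasure lborel {\<alpha> \<in> {0..1}. \<exists>q\<in>S i. int_dist (real q * \<alpha> - \<gamma>) < indicator U q * f q}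
          \<le> ennreal (2 * (1/2) ^ i)" .
    qed simp
  qed
  ultimately show ?thesis using U1 unc rat by blast
qed

end
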